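(* Let $\lambda$ be a nonzero real (or complex) number. For every $k\in\mathbb{N}=\{1,2,\dots\}$ and every integer $n\ge 0$, $$\beta_{n,\lambda}^{(k)}=(-1)^{n}\sum_{n_{1}+\cdots+n_{k}=n}\binom{n}{n_{1},n_{2},\dots,n_{k}}\frac{\beta_{n_{1},\lambda}(1-\lambda)}{n_{1}+1}\,\frac{\beta_{n_{2},\lambda}(1-\lambda)}{n_{1}+n_{2}+1}\cdots\frac{\beta_{n_{k-1},\lambda}(1-\lambda)}{n_{1}+n_{2}+\cdots+n_{k-1}+1}\,\beta_{n_{k},\lambda},$$ where the sum is over all $k$-tuples $(n_1,\dots,n_k)$ of nonnegative integers with sum $n$, $\binom{n}{n_1,\dots,n_k}=\frac{n!}{n_1!\cdots n_k!}$, and the product of the $k-1$ fractions is empty (equal to $1$) when $k=1$.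
   Context: All generating functions are formal power series. For nonzero $\lambda$ and any $x$, the degenerate exponential is $e_\lambda^x(t)=(1+\lambda t)^{x/\lambda}=\sum_{n\ge0}\binom{x/\lambda}{n}\lambda^n t^n$ and $e_\lambda(t)=e_\lambda^1(t)$. Carlitz's degenerate Bernoulli polynomials $\beta_{n,\lambda}(x)$ are defined by $\frac{t}{e_{\lambda}(t)-1}e_{\lambda}^{x}(t)=\sum_{n=0}^{\infty}\beta_{n,\lambda}(x)\frac{t^{n}}{n!}$, and $\beta_{n,\lambda}=\beta_{n,\lambda}(0)$. Here $\beta_{n,\lambda}(1-\lambda)$ denotes the value of this polynomial at $x=1-\lambda$. For nonzero $\mu$, put $(1)_{0,\mu}=1$ and $(1)_{n,\mu}=(1-\mu)(1-2\mu)\cdots(1-(n-1)\mu)$ for $n\ge1$ (so $(1)_{1,\mu}=1$). For $k\in\mathbb{Z}$ the degenerate polylogarithm function is $l_{k,\lambda}(x)=\sum_{n=1}^{\infty}\frac{(-\lambda)^{n-1}(1)_{n,1/\lambda}}{(n-1)!\,n^{k}}x^{n}$, and the degenerate poly-Bernoulli numbers $\beta_{n,\lambda}^{(k)}$ are defined by $$\frac{l_{k,\lambda}(1-e_{\lambda}(-t))}{1-e_{\lambda}(-t)}=\sum_{n=0}^{\infty}\beta_{n,\lambda}^{(k)}\frac{t^{n}}{n!},$$ i.e. by substituting $x=1-e_\lambda(-t)$ (which has zero constant term) into the power series $l_{k,\lambda}(x)/x$. *)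

theory Defs
  imports "HOL-Computational_Algebra.Formal_Power_Series"
begin

text \<open>With \<open>l\<close> for $\lambda$, \<open>degen_exp l x\<close> is $e_\lambda^x(t) = (1 + \lambda t)^{x/\lambda}$, as a power series in \<open>t\<close>.\<close>

definition degen_exp :: "'a::field_char_0 \<Rightarrow> 'a \<Rightarrow> 'a fps" where
  "degen_exp l x = Abs_fps (\<lambda>n. ((x / l) gchoose n) * l ^ n)"

text \<open>For \<open>l \<noteq> 0\<close> the series \<open>degen_exp l 1 - 1\<close> is \<open>t\<close> times a unit, so the division is exact.
  The polynomial variable \<open>x\<close> is the last argument.\<close>

definition degen_bernoulli :: "nat \<Rightarrow> 'a::field_char_0 \<Rightarrow> 'a \<Rightarrow> 'a" where
  "degen_bernoulli n l x =
     fact n * fps_nth (fps_X / (degen_exp l 1 - 1) * degen_exp l x) n"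

text \<open>$(1)_{n,m} = (1 - m)(1 - 2m) \cdots (1 - (n-1)m)$; the product is empty for \<open>n \<le> 1\<close>.\<close>

definition degen_falling_one :: "nat \<Rightarrow> 'a::field_char_0 \<Rightarrow> 'a" where
  "degen_falling_one n m = (\<Prod>j\<in>{1..<n}. 1 - of_nat j * m)"

definition degen_polylog :: "int \<Rightarrow> 'a::field_char_0 \<Rightarrow> 'a fps" where
  "degen_polylog k l =
     Abs_fps (\<lambda>n. if n = 0 then 0
       else (- l) ^ (n - 1) * degen_falling_one n (1 / l) / (fact (n - 1) * of_nat n powi k))"

text \<open>The argument \<open>1 - (degen_exp l 1 oo (- fps_X))\<close> is $1 - e_\lambda(-t)$; its constant term is zero,
  so the outer composition is a genuine substitution. The polylogarithm has no constant term either,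
  so dividing it by \<open>fps_X\<close> is exact.\<close>

definition degen_poly_bernoulli :: "nat \<Rightarrow> int \<Rightarrow> 'a::field_char_0 \<Rightarrow> 'a" where
  "degen_poly_bernoulli n k l =
     fact n * fps_nth ((degen_polylog k l / fps_X) oo (1 - (degen_exp l 1 oo (- fps_X)))) n"

definition multinomial :: "nat \<Rightarrow> nat list \<Rightarrow> 'a::field_char_0" where
  "multinomial n ns = fact n / (\<Prod>i<length ns. fact (ns ! i))"

end

theory Submission
  imports Defs
begin

unbundle fps_syntax

text \<open>Put $u = 1 - e_\lambda(s)$ and $M_k(s) = -l_{k,\lambda}(u)$. The logarithm $l_{1,\lambda}$ inverts
  $s \mapsto u$ up to sign, so $M_1 = s$, while $x\, l_{k+1,\lambda}'(x) = l_{k,\lambda}(x)$ gives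
  $M_{k+1}' = (M_k / s) \cdot \frac{s}{e_\lambda(s) - 1} e_\lambda^{1-\lambda}(s)$. Each integration
  contributes one convolution with $\beta_{n,\lambda}(1-\lambda)$ and one denominator $n + 1$. Finally
  $l_{k,\lambda}(u)/u = (M_k/s) \cdot \frac{s}{e_\lambda(s) - 1}$, and $s = -t$ gives the sign $(-1)^n$.\<close>

section \<open>Composition of binomial series\<close>

text \<open>The power law ((1+X)^b)^a = (1+X)^(ab) for formal series: the composition solves (1+X)
  f' = ab f with f(0) = 1, which determines f. The case a = l, b = 1/l later inverts the degenerate
  exponential.\<close>

lemma fps_binomial_compose_binomial:
  fixes a b :: "'a::field_char_0"
  shows "fps_binomial a oo (fps_binomial b - 1) = fps_binomial (a * b)"
proof -
  define E where "E = fps_binomial b"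
  define f where "f = fps_binomial a oo (E - 1)"
  have E0: "(E - 1) $ 0 = 0" by (simp add: E_def)
  have X: "fps_X oo (E - 1) = E - 1"
    by (rule fps_X_fps_compose_startby0[OF E0])
  have deriv: "(1 + fps_X) * fps_deriv (fps_binomial c) = fps_const c * fps_binomial c" for c :: 'a
    by (simp add: fps_binomial_deriv fps_divide_unit mult.commute[of _ "inverse _"]
        mult.assoc[symmetric] inverse_mult_eq_1)
  have "E * (fps_deriv (fps_binomial a) oo (E - 1)) = ((1 + fps_X) * fps_deriv (fps_binomial a)) oo (E - 1)"
    by (simp add: fps_compose_mult_distrib[OF E0] fps_compose_add_distrib X)
  also have "\<dots> = fps_const a * f"
    by (simp add: deriv fps_compose_mult_distrib[OF E0] f_def)
  finally have *: "E * (fps_deriv (fps_binomial a) oo (E - 1)) = fps_const a * f" .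
  have "(1 + fps_X) * fps_deriv f = (fps_deriv (fps_binomial a) oo (E - 1)) * ((1 + fps_X) * fps_deriv E)"
    by (simp add: f_def fps_compose_deriv[OF E0] mult_ac)
  also have "(1 + fps_X) * fps_deriv E = fps_const b * E"
    by (simp add: E_def deriv)
  also have "(fps_deriv (fps_binomial a) oo (E - 1)) * (fps_const b * E)
      = fps_const b * (E * (fps_deriv (fps_binomial a) oo (E - 1)))"
    by (simp only: mult_ac)
  also have "\<dots> = fps_const (a * b) * f"
    by (simp only: * mult.assoc[symmetric] fps_const_mult mult.commute[of b a])
  finally have "fps_const (a * b) * f = fps_deriv f * (1 + fps_X)"
    by (simp add: mult.commute)
  moreover have "(1 + fps_X :: 'a fps) \<noteq> 0"
    by (metis fps_add_nth fps_X_nth fps_one_nth fps_zero_nth add.right_neutral zero_neq_one)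
  ultimately have "fps_deriv f = fps_const (a * b) * f / (1 + fps_X)"
    by (simp add: fps_divide_times_eq)
  moreover have "f $ 0 = 1" by (simp add: f_def)
  ultimately show ?thesis
    using fps_binomial_ODE_unique'[of f "a * b"] by (simp add: f_def E_def)
qed

section \<open>The degenerate exponential\<close>

lemma degen_exp_nth_0 [simp]: "degen_exp l x $ 0 = 1"
  by (simp add: degen_exp_def)

lemma degen_exp_eq_compose:
  "degen_exp l x = fps_binomial (x / l) oo (fps_const l * fps_X)"
  unfolding fps_compose_linear degen_exp_def by (simp only: fps_binomial_nth mult.commute)

lemma degen_exp_0 [simp]: "degen_exp l 0 = 1"
  by (simp add: degen_exp_eq_compose)

text \<open>The shift from \<open>x\<close> to \<open>x - l\<close> comes from the absorption
  identity for binomial coefficients. The case \<open>x = 1\<close> is the source of the argument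
  \<open>1 - l\<close> in the theorem.\<close>

lemma fps_deriv_degen_exp:
  assumes "l \<noteq> 0"
  shows "fps_deriv (degen_exp l x) = fps_const x * degen_exp l (x - l)"
proof (rule fps_ext)
  fix n
  have "of_nat (Suc n) * (x / l gchoose Suc n) = x / l * (x / l - 1 gchoose n)"
    by (rule gbinomial_absorption)
  moreover have "x / l - 1 = (x - l) / l"
    using assms by (simp add: field_simps)
  ultimately show "fps_deriv (degen_exp l x) $ n = (fps_const x * degen_exp l (x - l)) $ n"
    using assms by (simp add: degen_exp_def mult.assoc[symmetric] del: of_nat_Suc)
qed

lemma degen_exp_minus_one_neq_0:
  assumes "l \<noteq> 0"
  shows "degen_exp l 1 - 1 \<noteq> 0"
proof
  assume "degen_exp l 1 - 1 = 0"
  then have "(degen_exp l 1 - 1) $ 1 = 0" by simp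
  with assms show False by (simp add: degen_exp_def)
qed

lemma X_div_degen_exp_mult:
  assumes "l \<noteq> 0"
  shows "fps_X / (degen_exp l 1 - 1) * (degen_exp l 1 - 1) = fps_X"
proof -
  \<comment> \<open>The linear coefficient of \<open>degen_exp l 1\<close> is (1/l) * l = 1, so the
    divisor is X times a unit and the division is exact.\<close>
  have "subdegree (degen_exp l 1 - 1) = 1"
    by (rule subdegreeI) (use assms in \<open>auto simp: degen_exp_def\<close>)
  then show ?thesis
    using fps_divide_times2[of "degen_exp l 1 - 1" fps_X "degen_exp l 1 - 1"]
      fps_divide_times_eq[OF degen_exp_minus_one_neq_0[OF assms]] by simp
qed

section \<open>The degenerate polylogarithm and logarithm\<close>

text \<open>Each factor -l (1 - j/l) equals j - l. This turns the numerators of the polylogarithm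
  into the rising factorials hidden in \<open>l gchoose n\<close>.\<close>

lemma pochhammer_eq_degen_falling_one:
  assumes "l \<noteq> 0"
  shows "(- l) ^ m * degen_falling_one (Suc m) (1 / l) = pochhammer (1 - l) m"
proof (induction m)
  case (Suc m)
  have step: "degen_falling_one (Suc (Suc m)) (1 / l)
      = degen_falling_one (Suc m) (1 / l) * (1 - of_nat (Suc m) / l)"
    by (simp add: degen_falling_one_def)
  have factor: "1 - l + of_nat m = - l * (1 - of_nat (Suc m) / l)"
    using assms by (simp add: field_simps)
  have "(- l) ^ Suc m * degen_falling_one (Suc (Suc m)) (1 / l)
      = ((- l) ^ m * degen_falling_one (Suc m) (1 / l)) * (1 - l + of_nat m)"
    by (simp only: step factor power_Suc mult_ac)
  then show ?case by (simp only: Suc.IH pochhammer_Suc)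
qed (simp add: degen_falling_one_def)

lemma degen_polylog_nth_0 [simp]: "degen_polylog k l $ 0 = 0"
  by (simp add: degen_polylog_def)

text \<open>At index 1 the denominator (n-1)! n is n!, so the series is the degenerate logarithm (1
  - (1-x)^l)/l.\<close>

lemma degen_polylog_1_eq:
  assumes "l \<noteq> 0"
  shows "degen_polylog 1 l = fps_const (1 / l) * (1 - (fps_binomial l oo (- fps_X)))"
proof (rule fps_ext)
  fix n
  show "degen_polylog 1 l $ n = (fps_const (1 / l) * (1 - (fps_binomial l oo (- fps_X)))) $ n"
  proof (cases n)
    case (Suc m)
    have binomial: "l gchoose Suc m = (- 1) ^ Suc m * (- l * pochhammer (1 - l) m) / fact (Suc m)"
      by (simp add: gbinomial_pochhammer pochhammer_rec add.commute)
    have "(- 1) ^ Suc m * (- 1) ^ Suc m = (1 :: 'a)"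
      by (simp only: power_mult_distrib[symmetric]) simp
    then have "(- 1) ^ Suc m * (l gchoose Suc m) = - l * pochhammer (1 - l) m / fact (Suc m)"
      by (simp only: binomial times_divide_eq_right mult.assoc[symmetric] mult_1_left)
    then show ?thesis
      using assms pochhammer_eq_degen_falling_one[OF assms, of m] Suc
      by (simp add: degen_polylog_def fps_compose_uminus' mult.commute del: power_Suc)
  qed simp
qed

text \<open>For x = 1 - e_l(s) one has 1 - x = (1+ls)^(1/l), hence (1-x)^l = 1+ls, and the
  degenerate logarithm returns -s.\<close>

lemma degen_polylog_1_compose:
  assumes "l \<noteq> 0"
  shows "degen_polylog 1 l oo (1 - degen_exp l 1) = - fps_X"
proof -
  define D where "D = degen_exp l 1 - 1"
  have D0: "D $ 0 = 0" "(- D) $ 0 = 0" by (simp_all add: D_def)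
  have D: "D = (fps_binomial (1 / l) - 1) oo (fps_const l * fps_X)"
    by (simp add: D_def degen_exp_eq_compose fps_compose_sub_distrib)
  have "fps_binomial l oo D = (fps_binomial l oo (fps_binomial (1 / l) - 1)) oo (fps_const l * fps_X)"
    unfolding D by (rule fps_compose_assoc) simp_all
  also have "\<dots> = 1 + fps_const l * fps_X"
    using assms by (simp add: fps_binomial_compose_binomial fps_binomial_1 fps_compose_add_distrib)
  finally have *: "fps_binomial l oo D = 1 + fps_const l * fps_X" .
  have "fps_binomial l oo (- fps_X) oo (- D) = fps_binomial l oo (- fps_X oo (- D))"
    by (rule fps_compose_assoc[symmetric]) (simp_all add: D0)
  also have "- fps_X oo (- D) = D"
    by (simp add: fps_compose_uminus D0)
  finally have "fps_binomial l oo (- fps_X) oo (- D) = 1 + fps_const l * fps_X"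
    by (simp add: *)
  then have "degen_polylog 1 l oo (- D) = fps_const (1 / l) * (1 - (1 + fps_const l * fps_X))"
    by (simp add: degen_polylog_1_eq[OF assms] fps_compose_mult_distrib[OF D0(2)] fps_compose_sub_distrib)
  also have "\<dots> = - fps_X"
    using assms by (simp add: mult.assoc[symmetric])
  finally show ?thesis by (simp add: D_def)
qed

lemma X_mult_deriv_degen_polylog:
  "fps_X * fps_deriv (degen_polylog (int (Suc k)) l) = degen_polylog (int k) l"
proof (rule fps_ext)
  fix n
  show "(fps_X * fps_deriv (degen_polylog (int (Suc k)) l)) $ n = degen_polylog (int k) l $ n"
  proof (cases n)
    case (Suc m)
    have "of_nat (Suc m) powi int k = of_nat (Suc m) ^ k"
      "of_nat (Suc m) powi int (Suc k) = (of_nat (Suc m) ^ Suc k :: 'a)"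
      by (simp_all only: power_int_of_nat)
    then show ?thesis
      using Suc by (simp add: degen_polylog_def del: of_nat_Suc)
  qed simp
qed

text \<open>\<open>polylog_quotient m l\<close> turns out to be $-l_{m+1,\lambda}(1 - e_\lambda(s)) / s$.\<close>

primrec polylog_quotient :: "nat \<Rightarrow> 'a::field_char_0 \<Rightarrow> 'a fps" where
  "polylog_quotient 0 l = 1"
| "polylog_quotient (Suc m) l =
     Abs_fps (\<lambda>n. (polylog_quotient m l * (fps_X / (degen_exp l 1 - 1) * degen_exp l (1 - l))) $ n
       / of_nat (n + 1))"

lemma X_mult_polylog_quotient:
  assumes "l \<noteq> 0"
  shows "degen_polylog (int (Suc m)) l oo (1 - degen_exp l 1) = - (fps_X * polylog_quotient m l)"
proof (induction m)
  case 0
  then show ?case using degen_polylog_1_compose[OF assms] by simp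
next
  case (Suc m)
  define D where "D = degen_exp l 1 - 1"
  define H where "H = degen_exp l (1 - l)"
  define Q where "Q = fps_X / D"
  define P where "P = degen_polylog (int (Suc (Suc m))) l"
  have D0: "D $ 0 = 0" "(- D) $ 0 = 0" by (simp_all add: D_def)
  have QD: "Q * D = fps_X"
    unfolding Q_def D_def by (rule X_div_degen_exp_mult[OF assms])
  have Dne: "D \<noteq> 0"
    unfolding D_def by (rule degen_exp_minus_one_neq_0[OF assms])
  have D': "fps_deriv D = H"
    by (simp add: D_def H_def fps_deriv_degen_exp[OF assms])
  have IH: "degen_polylog (int (Suc m)) l oo (- D) = - (fps_X * polylog_quotient m l)"
    using Suc.IH by (simp add: D_def)
  have "- D * (fps_deriv P oo (- D)) = (fps_X * fps_deriv P) oo (- D)"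
    by (simp add: fps_compose_mult_distrib[OF D0(2)] D0)
  \<comment> \<open>Writing X as \<open>Q * D\<close> exposes the nonzero factor \<open>D\<close>,
    which can then be cancelled.\<close>
  also have "\<dots> = - (Q * D * polylog_quotient m l)"
    by (simp only: P_def X_mult_deriv_degen_polylog IH QD)
  finally have "D * (fps_deriv P oo (- D)) = D * (Q * polylog_quotient m l)"
    by (simp add: mult_ac)
  then have PD: "fps_deriv P oo (- D) = Q * polylog_quotient m l"
    using Dne by simp
  have "fps_deriv (P oo (- D)) = - (polylog_quotient m l * (Q * H))"
    by (simp add: fps_compose_deriv[OF D0(2)] PD D' mult_ac)
  \<comment> \<open>The factor n+1 from differentiating X times the quotient cancels the division in
    the recursive definition.\<close>
  also have "\<dots> = fps_deriv (- (fps_X * polylog_quotient (Suc m) l))"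
    by (rule fps_ext) (simp add: Q_def D_def H_def add.commute del: of_nat_Suc fps_deriv_mult)
  \<comment> \<open>Equal derivatives leave only the constant terms to compare, and both
    vanish.\<close>
  finally have "P oo (- D) = - (fps_X * polylog_quotient (Suc m) l)"
    unfolding fps_deriv_eq_iff by (simp add: P_def)
  then show ?case by (simp add: P_def D_def)
qed

lemma degen_poly_bernoulli_eq:
  assumes "l \<noteq> 0"
  shows "degen_poly_bernoulli n (int (Suc m)) l
    = (- 1) ^ n * fact n * (polylog_quotient m l * (fps_X / (degen_exp l 1 - 1))) $ n"
proof -
  define D where "D = degen_exp l 1 - 1"
  define Q where "Q = fps_X / D"
  define R where "R = degen_polylog (int (Suc m)) l / fps_X"
  have D0: "D $ 0 = 0" "(- D) $ 0 = 0" by (simp_all add: D_def)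
  have QD: "Q * D = fps_X"
    unfolding Q_def D_def by (rule X_div_degen_exp_mult[OF assms])
  have Dne: "D \<noteq> 0"
    unfolding D_def by (rule degen_exp_minus_one_neq_0[OF assms])
  have R: "degen_polylog (int (Suc m)) l = R * fps_X"
    by (rule fps_ext) (auto simp: R_def)
  have "(R oo (- D)) * (- D) = degen_polylog (int (Suc m)) l oo (- D)"
    unfolding R by (simp add: fps_compose_mult_distrib[OF D0(2)] D0)
  also have "\<dots> = - (Q * D * polylog_quotient m l)"
    using X_mult_polylog_quotient[OF assms, of m] by (simp add: D_def QD[unfolded D_def])
  finally have "D * (R oo (- D)) = D * (polylog_quotient m l * Q)"
    by (simp add: mult_ac)
  then have RD: "R oo (- D) = polylog_quotient m l * Q"
    using Dne by simp
  \<comment> \<open>This is the substitution s = -t, which multiplies the n-th coefficient by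
    (-1)^n.\<close>
  have "1 - (degen_exp l 1 oo (- fps_X)) = - D oo (- fps_X)"
    by (simp add: D_def fps_compose_sub_distrib)
  then have "R oo (1 - (degen_exp l 1 oo (- fps_X))) = (R oo (- D)) oo (- fps_X)"
    by (simp add: fps_compose_assoc D0)
  then show ?thesis
    unfolding degen_poly_bernoulli_def R_def[symmetric]
    by (simp add: RD fps_compose_uminus' flip: Q_def D_def)
qed

section \<open>Expansion into sums over lists with prescribed sum\<close>

text \<open>Splitting off the last entry gives the shape of a Cauchy product: \<open>m\<close> is
  the sum of the other entries and \<open>n - m\<close> is the last one.\<close>

lemma sum_lists_snoc:
  fixes f :: "nat list \<Rightarrow> 'a::comm_monoid_add"
  shows "(\<Sum>ns | length ns = Suc k \<and> sum_list ns = n. f ns)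
    = (\<Sum>m\<le>n. \<Sum>ns | length ns = k \<and> sum_list ns = m. f (ns @ [n - m]))"
proof -
  have fin: "finite {ns :: nat list. length ns = k \<and> sum_list ns = m}" for m
    by (rule finite_subset[OF _ finite_lists_length_eq[of "{..m}" k]])
      (auto dest: member_le_sum_list)
  have "(\<Sum>m\<le>n. \<Sum>ns | length ns = k \<and> sum_list ns = m. f (ns @ [n - m]))
      = (\<Sum>(m, ns)\<in>Sigma {..n} (\<lambda>m. {ns. length ns = k \<and> sum_list ns = m}). f (ns @ [n - m]))"
    by (rule sum.Sigma) (use fin in auto)
  also have "\<dots> = (\<Sum>ns | length ns = Suc k \<and> sum_list ns = n. f ns)"
  proof (rule sum.reindex_bij_witness[where i = "\<lambda>ns. (sum_list (butlast ns), butlast ns)"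
        and j = "\<lambda>(m, ns). ns @ [n - m]"]; clarsimp)
    fix ns :: "nat list"
    assume "length ns = Suc k"
    then obtain xs x where "ns = xs @ [x]" by (cases ns rule: rev_cases) auto
    then show "butlast ns @ [sum_list ns - sum_list (butlast ns)] = ns"
      and "sum_list (butlast ns) \<le> sum_list ns" by simp_all
  qed
  finally show ?thesis ..
qed

text \<open>Each step of the recursion appends one entry by convolution and divides by the
  coefficient index plus one; that index is the sum of the entries so far.\<close>

lemma polylog_quotient_nth:
  "polylog_quotient k l $ n = (\<Sum>ns | length ns = k \<and> sum_list ns = n.
     \<Prod>i<k. degen_bernoulli (ns ! i) l (1 - l) / fact (ns ! i) / of_nat ((\<Sum>j\<le>i. ns ! j) + 1))"
proof (induction k arbitrary: n)
  case 0
  have "{ns :: nat list. length ns = 0 \<and> sum_list ns = n} = (if n = 0 then {[]} else {})" by auto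
  then show ?case by simp
next
  case (Suc k)
  define G where "G = fps_X / (degen_exp l 1 - 1) * degen_exp l (1 - l)"
  define g where "g n = degen_bernoulli n l (1 - l) / fact n" for n
  have g: "g n = G $ n" for n by (simp add: g_def G_def degen_bernoulli_def)
  define w where "w ns i = g (ns ! i) / of_nat ((\<Sum>j\<le>i. ns ! j) + 1)" for ns i
  have IH: "polylog_quotient k l $ n = (\<Sum>ns | length ns = k \<and> sum_list ns = n. \<Prod>i<k. w ns i)" for n
    by (simp add: Suc.IH w_def g_def)
  \<comment> \<open>Appending \<open>n - m\<close> leaves the earlier partial sums alone and brings
    the total to \<open>n\<close>, so the new denominator does not depend on
    \<open>m\<close>.\<close>
  have w_snoc: "(\<Prod>i<Suc k. w (ns @ [n - m]) i) = (\<Prod>i<k. w ns i) * G $ (n - m) / of_nat (n + 1)"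
    if "length ns = k" "sum_list ns = m" "m \<le> n" for ns m
  proof -
    have "(\<Sum>j\<le>i. (ns @ [n - m]) ! j) = (\<Sum>j\<le>i. ns ! j)" if "i < k" for i
      using that \<open>length ns = k\<close> by (intro sum.cong) (auto simp: nth_append)
    then have init: "(\<Prod>i<k. w (ns @ [n - m]) i) = (\<Prod>i<k. w ns i)"
      using \<open>length ns = k\<close> by (intro prod.cong) (auto simp: w_def nth_append)
    have total: "(\<Sum>j\<le>k. (ns @ [n - m]) ! j) = n"
    proof -
      have "(\<Sum>j\<le>k. (ns @ [n - m]) ! j) = sum_list (ns @ [n - m])"
        using that by (simp only: sum_list_sum_nth atLeast0LessThan) (simp add: lessThan_Suc_atMost)
      with that show ?thesis by simp
    qed
    have "w (ns @ [n - m]) k = G $ (n - m) / of_nat (n + 1)"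
      unfolding w_def total using that by (simp add: g nth_append)
    with init show ?thesis by simp
  qed
  have "polylog_quotient (Suc k) l $ n = (\<Sum>m\<le>n. polylog_quotient k l $ m * G $ (n - m)) / of_nat (n + 1)"
    by (simp add: G_def[symmetric] fps_mult_nth atLeast0AtMost)
  also have "\<dots> = (\<Sum>m\<le>n. \<Sum>ns | length ns = k \<and> sum_list ns = m.
      (\<Prod>i<k. w ns i) * G $ (n - m) / of_nat (n + 1))"
    by (simp add: IH sum_distrib_right sum_divide_distrib)
  also have "\<dots> = (\<Sum>m\<le>n. \<Sum>ns | length ns = k \<and> sum_list ns = m. \<Prod>i<Suc k. w (ns @ [n - m]) i)"
    by (intro sum.cong refl) (simp add: w_snoc del: prod.lessThan_Suc)
  also have "\<dots> = (\<Sum>ns | length ns = Suc k \<and> sum_list ns = n. \<Prod>i<Suc k. w ns i)"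
    by (rule sum_lists_snoc[symmetric])
  finally show ?case by (simp add: w_def g_def)
qed

theorem theorem6:
  fixes l :: "'a::real_normed_field" and k n :: nat
  assumes "l \<noteq> 0" and "k \<ge> 1"
  shows "degen_poly_bernoulli n (int k) l =
    (- 1) ^ n *
    (\<Sum>ns\<in>{ns :: nat list. length ns = k \<and> sum_list ns = n}.
       multinomial n ns *
       (\<Prod>i<k - 1. degen_bernoulli (ns ! i) l (1 - l) / of_nat ((\<Sum>j\<le>i. ns ! j) + 1)) *
       degen_bernoulli (ns ! (k - 1)) l 0)"
proof -
  obtain m where k: "k = Suc m" using assms(2) by (cases k) auto
  define b where "b ns i = degen_bernoulli (ns ! i) l (1 - l) / of_nat ((\<Sum>j\<le>i. ns ! j) + 1)" for ns i
  define Q where "Q = fps_X / (degen_exp l 1 - 1)"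
  \<comment> \<open>At \<open>x = 0\<close> the exponential factor is 1, so \<open>Q\<close> alone
    generates the degenerate Bernoulli numbers.\<close>
  have Q: "Q $ j = degen_bernoulli j l 0 / fact j" for j
    by (simp add: Q_def degen_bernoulli_def)
  have A: "polylog_quotient m l $ j = (\<Sum>ns | length ns = m \<and> sum_list ns = j. \<Prod>i<m. b ns i / fact (ns ! i))"
    for j
    unfolding polylog_quotient_nth b_def by (intro sum.cong prod.cong refl) simp
  \<comment> \<open>The last convolution, with \<open>Q\<close>, involves no integration, so the
    last factor has no partial-sum denominator. The factorials of the multinomial coefficient are
    spread over the factors.\<close>
  have snoc: "multinomial n (ns @ [n - j]) * (\<Prod>i<m. b (ns @ [n - j]) i) * degen_bernoulli ((ns @ [n - j]) ! m) l 0
      = fact n * ((\<Prod>i<m. b ns i / fact (ns ! i)) * Q $ (n - j))" if "length ns = m" for ns j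
  proof -
    have "(\<Sum>p\<le>i. (ns @ [n - j]) ! p) = (\<Sum>p\<le>i. ns ! p)" if "i < m" for i
      using that \<open>length ns = m\<close> by (intro sum.cong) (auto simp: nth_append)
    then have "(\<Prod>i<m. b (ns @ [n - j]) i) = (\<Prod>i<m. b ns i)"
      using \<open>length ns = m\<close> by (intro prod.cong) (auto simp: b_def nth_append)
    moreover have "(\<Prod>i<m. fact ((ns @ [n - j]) ! i)) = (\<Prod>i<m. fact (ns ! i) :: 'a)"
      using that by (intro prod.cong) (auto simp: nth_append)
    ultimately show ?thesis
      using that by (simp add: multinomial_def Q prod_dividef nth_append)
  qed
  have "degen_poly_bernoulli n (int k) l = (- 1) ^ n * (fact n * (polylog_quotient m l * Q) $ n)"
    by (simp only: k degen_poly_bernoulli_eq[OF assms(1)] Q_def mult.assoc)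
  also have "fact n * (polylog_quotient m l * Q) $ n
      = (\<Sum>j\<le>n. \<Sum>ns | length ns = m \<and> sum_list ns = j.
          fact n * ((\<Prod>i<m. b ns i / fact (ns ! i)) * Q $ (n - j)))"
    by (simp add: fps_mult_nth atLeast0AtMost A sum_distrib_left sum_distrib_right)
  also have "\<dots> = (\<Sum>j\<le>n. \<Sum>ns | length ns = m \<and> sum_list ns = j.
      multinomial n (ns @ [n - j]) * (\<Prod>i<m. b (ns @ [n - j]) i) * degen_bernoulli ((ns @ [n - j]) ! m) l 0)"
    by (intro sum.cong refl) (simp add: snoc)
  also have "\<dots> = (\<Sum>ns | length ns = k \<and> sum_list ns = n.
      multinomial n ns * (\<Prod>i<m. b ns i) * degen_bernoulli (ns ! m) l 0)"
    unfolding k by (rule sum_lists_snoc[symmetric])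
  finally show ?thesis by (simp add: k b_def)
qed

end
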